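(* Let $\pi_1=(J_1,\mathbf{A}_1,b_1,\mathbf{B}_1)$ and $\pi_2=(J_2,\mathbf{A}_2,b_2,\mathbf{B}_2)$ be two semidefinite programs with non-negativity constraints (as defined in the context) for which strong duality holds. Suppose the following two conditions hold: 1. (Bipartiteness) For each $i\in\{1,2\}$ there is a partition of the index set of rows and columns of the matrices of $\pi_i$ into two sets such that, with respect to this partition, $J_i$ and all the matrices of $\mathbf{B}_i$ are block anti-diagonal, and all the matrices of $\mathbf{A}_i$ are block diagonal. 2. There are entrywise non-negative vectors $u_1,u_2$ such that $J_1=u_1^T\mathbf{B}_1$ and $J_2=u_2^T\mathbf{B}_2$. Then $\alpha(\pi_1\times\pi_2)\le\alpha(\pi_1)\,\alpha(\pi_2)$.
   Context: All matrices and vectors are real. $A\succeq 0$ means that $A$ is symmetric and $v^TAv\ge 0$ for all vectors $v$. For matrices of the same dimensions, $A\bullet B=\sum_{x,y}A[x,y]B[x,y]=\mathrm{Tr}(AB^T)$. For vectors, $v\ge w$ means entrywise inequality, and $\mathbf{0}$ is the all-zero vector. A semidefinite program with non-negativity constraints is a tuple $\pi=(J,\mathbf{A},b,\mathbf{B})$, where, for some $n$, $J$ is an $n\times n$ matrix, $\mathbf{A}=(A_1,\dots,A_m)$ and $\mathbf{B}=(B_1,\dots,B_l)$ are tuples of $n\times n$ matrices, and $b\in\mathbb{R}^m$. The matrices $J$, $A_k$, $B_k$ need not be symmetric. Write $\mathbf{A}\bullet X=(A_1\bullet X,\dots,A_m\bullet X)$, and for $y\in\mathbb{R}^m$ write $y^T\mathbf{A}=\sum_{k}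 y_kA_k$; similarly for $\mathbf{B}$. The value of $\pi$ is $$\alpha(\pi)=\max_X\; J\bullet X\quad\text{such that}\quad \mathbf{A}\bullet X=b,\quad \mathbf{B}\bullet X\ge\mathbf{0},\quad X\succeq 0 ,$$ where $X$ ranges over $n\times n$ matrices. The dual value is $$\alpha^*(\pi)=\min_{y,z}\; y^Tb\quad\text{such that}\quad y^T\mathbf{A}-(z^T\mathbf{B}+J)\succeq 0,\quad z\ge\mathbf{0}.$$ Here max and min denote optimal values (supremum and infimum over feasible points). Strong duality holds for $\pi$ if the optimal primal and dual values agree, i.e. $\alpha(\pi)=\alpha^*(\pi)$, this common value being a finite real number. The product of two programs, whose matrix sizes may differ, is $$\pi_1\times\pi_2=(J_1\otimes J_2,\ \mathbf{A}_1\otimes\mathbf{A}_2,\ b_1\otimes b_2,\ \mathbf{B}_1\otimes\mathbf{B}_2),$$ where $\otimes$ between matrices or vectors is the Kronecker product. The tensor product of a tuple of $m_1$ matrices with a tuple of $m_2$ matrices is the tuple of all $m_1m_2$ matrices $\mathbf{A}_1[i]\otimes\mathbf{A}_2[j]$, indexed compatibly with $b_1\otimes b_2$ (so the constraint for the pair $(i,j)$ has right-hand side $b_1[i]\,b_2[j]$). Given a partition of the index set $\{1,\dots,n\}$ (used for both rows and columns) into two sets $P,Q$, an $n\times n$ matrix $M$ is block diagonal if $M[x,y]=0$ whenever $x,y$ lie in different parts, and block anti-diagonal if $M[x,y]=0$ whenever $x,y$ lie in the same part. *)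

theory Defs
  imports "Jordan_Normal_Form.Matrix" "HOL-Library.Extended_Real"
begin

definition psd :: "real mat \<Rightarrow> bool" where
  "psd M \<longleftrightarrow> square_mat M \<and> transpose_mat M = M \<and>
     (\<forall>v \<in> carrier_vec (dim_row M). 0 \<le> v \<bullet> (M *\<^sub>v v))"

definition mat_inner :: "real mat \<Rightarrow> real mat \<Rightarrow> real" where
  "mat_inner A X = (\<Sum>x<dim_row A. \<Sum>y<dim_col A. A $$ (x, y) * X $$ (x, y))"

definition tuple_inner :: "real mat list \<Rightarrow> real mat \<Rightarrow> real vec" where
  "tuple_inner As X = vec (length As) (\<lambda>k. mat_inner (As ! k) X)"

text \<open>The combination \<open>\<Sum>k. y\<^sub>k A\<^sub>k\<close> of \<open>n \<times> n\<close> matrices. The size \<open>n\<close> is explicit because the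
  tuple may be empty, in which case the result is the zero matrix.\<close>
definition tuple_comb :: "nat \<Rightarrow> real vec \<Rightarrow> real mat list \<Rightarrow> real mat" where
  "tuple_comb n y As = mat n n (\<lambda>(i, j). \<Sum>k<length As. y $ k * (As ! k) $$ (i, j))"

text \<open>With a second factor of size \<open>q\<close>, the index \<open>k\<close> encodes the pair \<open>(k div q, k mod q)\<close>;
  the same encoding is used for matrices, vectors and tuples, so that the entries of
  \<open>tuple_kron As Bs\<close> and \<open>vec_kron b c\<close> at position \<open>k\<close> belong to the same pair.\<close>
definition mat_kron :: "real mat \<Rightarrow> real mat \<Rightarrow> real mat" where
  "mat_kron A B = mat (dim_row A * dim_row B) (dim_col A * dim_col B)
     (\<lambda>(i, j). A $$ (i div dim_row B, j div dim_col B) * B $$ (i mod dim_row B, j mod dim_col B))"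

definition vec_kron :: "real vec \<Rightarrow> real vec \<Rightarrow> real vec" where
  "vec_kron b c = vec (dim_vec b * dim_vec c) (\<lambda>k. b $ (k div dim_vec c) * c $ (k mod dim_vec c))"

definition tuple_kron :: "real mat list \<Rightarrow> real mat list \<Rightarrow> real mat list" where
  "tuple_kron As Bs = map (\<lambda>k. mat_kron (As ! (k div length Bs)) (Bs ! (k mod length Bs)))
     [0..<length As * length Bs]"

record sdp =
  sdp_J :: "real mat"
  sdp_A :: "real mat list"
  sdp_b :: "real vec"
  sdp_B :: "real mat list"

definition sdp_dim :: "sdp \<Rightarrow> nat" where
  "sdp_dim \<pi> = dim_row (sdp_J \<pi>)"

definition wf_sdp :: "sdp \<Rightarrow> bool" where
  "wf_sdp \<pi> \<longleftrightarrow>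
     sdp_J \<pi> \<in> carrier_mat (sdp_dim \<pi>) (sdp_dim \<pi>) \<and>
     set (sdp_A \<pi>) \<subseteq> carrier_mat (sdp_dim \<pi>) (sdp_dim \<pi>) \<and>
     sdp_b \<pi> \<in> carrier_vec (length (sdp_A \<pi>)) \<and>
     set (sdp_B \<pi>) \<subseteq> carrier_mat (sdp_dim \<pi>) (sdp_dim \<pi>)"

definition primal_feasible :: "sdp \<Rightarrow> real mat set" where
  "primal_feasible \<pi> = {X \<in> carrier_mat (sdp_dim \<pi>) (sdp_dim \<pi>).
     tuple_inner (sdp_A \<pi>) X = sdp_b \<pi> \<and>
     0\<^sub>v (length (sdp_B \<pi>)) \<le> tuple_inner (sdp_B \<pi>) X \<and>
     psd X}"

definition dual_feasible :: "sdp \<Rightarrow> (real vec \<times> real vec) set" where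
  "dual_feasible \<pi> =
     {(y, z). y \<in> carrier_vec (length (sdp_A \<pi>)) \<and> z \<in> carrier_vec (length (sdp_B \<pi>)) \<and>
        psd (tuple_comb (sdp_dim \<pi>) y (sdp_A \<pi>)
             - (tuple_comb (sdp_dim \<pi>) z (sdp_B \<pi>) + sdp_J \<pi>)) \<and>
        0\<^sub>v (length (sdp_B \<pi>)) \<le> z}"

text \<open>The optimal values are extended reals: an infeasible primal has value \<open>-\<infinity>\<close>, an infeasible
  dual has value \<open>\<infinity>\<close>, and neither optimum needs to be attained.\<close>
definition primal_value :: "sdp \<Rightarrow> ereal" where
  "primal_value \<pi> = (SUP X \<in> primal_feasible \<pi>. ereal (mat_inner (sdp_J \<pi>) X))"

definition dual_value :: "sdp \<Rightarrow> ereal" where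
  "dual_value \<pi> = (INF (y, z) \<in> dual_feasible \<pi>. ereal (y \<bullet> sdp_b \<pi>))"

definition strong_duality :: "sdp \<Rightarrow> bool" where
  "strong_duality \<pi> \<longleftrightarrow> (\<exists>r::real. primal_value \<pi> = ereal r \<and> dual_value \<pi> = ereal r)"

definition sdp_prod :: "sdp \<Rightarrow> sdp \<Rightarrow> sdp" where
  "sdp_prod \<pi>\<^sub>1 \<pi>\<^sub>2 =
     \<lparr>sdp_J = mat_kron (sdp_J \<pi>\<^sub>1) (sdp_J \<pi>\<^sub>2),
      sdp_A = tuple_kron (sdp_A \<pi>\<^sub>1) (sdp_A \<pi>\<^sub>2),
      sdp_b = vec_kron (sdp_b \<pi>\<^sub>1) (sdp_b \<pi>\<^sub>2),
      sdp_B = tuple_kron (sdp_B \<pi>\<^sub>1) (sdp_B \<pi>\<^sub>2)\<rparr>"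

definition block_diagonal :: "nat set \<Rightarrow> nat set \<Rightarrow> real mat \<Rightarrow> bool" where
  "block_diagonal P Q M \<longleftrightarrow>
     (\<forall>x y. x \<in> P \<and> y \<in> Q \<or> x \<in> Q \<and> y \<in> P \<longrightarrow> M $$ (x, y) = 0)"

definition block_antidiagonal :: "nat set \<Rightarrow> nat set \<Rightarrow> real mat \<Rightarrow> bool" where
  "block_antidiagonal P Q M \<longleftrightarrow>
     (\<forall>x y. x \<in> P \<and> y \<in> P \<or> x \<in> Q \<and> y \<in> Q \<longrightarrow> M $$ (x, y) = 0)"

text \<open>Either part of the partition may be empty.\<close>
definition bipartite_sdp :: "sdp \<Rightarrow> bool" where
  "bipartite_sdp \<pi> \<longleftrightarrow> (\<exists>P Q. P \<union> Q = {..<sdp_dim \<pi>} \<and> P \<inter> Q = {} \<and>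
     block_antidiagonal P Q (sdp_J \<pi>) \<and>
     (\<forall>M \<in> set (sdp_B \<pi>). block_antidiagonal P Q M) \<and>
     (\<forall>M \<in> set (sdp_A \<pi>). block_diagonal P Q M))"

end

theory Submission
  imports Defs
begin

text \<open>For dual feasible \<open>(y\<^sub>i, z\<^sub>i)\<close> put \<open>D\<^sub>i = y\<^sub>i\<^sup>T A\<^sub>i\<close> and \<open>E\<^sub>i = z\<^sub>i\<^sup>T B\<^sub>i + J\<^sub>i\<close>. Conjugating
  \<open>D\<^sub>i - E\<^sub>i \<succeq> 0\<close> with the diagonal sign matrix of the bipartition gives \<open>D\<^sub>i + E\<^sub>i \<succeq> 0\<close>, so
  \<open>2 (D\<^sub>1 \<otimes> D\<^sub>2 - E\<^sub>1 \<otimes> E\<^sub>2) = (D\<^sub>1 - E\<^sub>1) \<otimes> (D\<^sub>2 + E\<^sub>2) + (D\<^sub>1 + E\<^sub>1) \<otimes> (D\<^sub>2 - E\<^sub>2)\<close> is positive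
  semidefinite. Since \<open>J\<^sub>i = u\<^sub>i\<^sup>T B\<^sub>i\<close>, the difference \<open>E\<^sub>1 \<otimes> E\<^sub>2 - J\<^sub>1 \<otimes> J\<^sub>2\<close> is a non-negative
  combination of the \<open>B\<^sub>1[i] \<otimes> B\<^sub>2[j]\<close>. Hence the value of the product program is at most
  \<open>(y\<^sub>1 \<bullet> b\<^sub>1) (y\<^sub>2 \<bullet> b\<^sub>2)\<close>, and both factors can be brought arbitrarily close to the optimal values.\<close>

section \<open>Positive semidefinite forms and their Gram representation\<close>

lemma quadratic_form_eq_sum:
  fixes M :: "real mat"
  assumes "M \<in> carrier_mat n n" "v \<in> carrier_vec n"
  shows "v \<bullet> (M *\<^sub>v v) = (\<Sum>i<n. \<Sum>j<n. v $ i * M $$ (i, j) * v $ j)"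
  using assms
  by (auto simp: scalar_prod_def atLeast0LessThan sum_distrib_left mult.assoc intro!: sum.cong)

lemma psd_quadratic_form_nonneg:
  assumes "psd M" "M \<in> carrier_mat n n"
  shows "0 \<le> (\<Sum>i<n. \<Sum>j<n. v i * M $$ (i, j) * v j)"
proof -
  have "0 \<le> vec n v \<bullet> (M *\<^sub>v vec n v)"
    using assms by (auto simp: psd_def)
  then show ?thesis
    using assms by (simp add: quadratic_form_eq_sum[of M n])
qed

lemma psd_symmetric:
  assumes "psd M" "M \<in> carrier_mat n n" "i < n" "j < n"
  shows "M $$ (i, j) = M $$ (j, i)"
proof -
  have "transpose_mat M = M" using assms(1) by (simp add: psd_def)
  then have "M $$ (i, j) = transpose_mat M $$ (i, j)" by simp
  then show ?thesis using assms by simp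
qed

text \<open>Serves to show that a vanishing diagonal entry of a nonnegative form forces its row to
  vanish.\<close>

lemma nonneg_affine_imp_slope_zero:
  fixes a b :: real
  assumes "\<And>t. 0 \<le> a + t * b"
  shows "b = 0"
proof (rule ccontr)
  assume "b \<noteq> 0"
  then have "a + (- (a + 1) / b) * b = -1" by simp
  with assms[of "- (a + 1) / b"] show False by simp
qed

text \<open>The induction eliminates the last index by a Schur complement.\<close>
lemma quadratic_form_nonneg_imp_gram:
  fixes f :: "nat \<Rightarrow> nat \<Rightarrow> real"
  assumes "\<And>i j. i < n \<Longrightarrow> j < n \<Longrightarrow> f i j = f j i"
    and "\<And>v. 0 \<le> (\<Sum>i<n. \<Sum>j<n. v i * f i j * v j)"
  shows "\<exists>p :: nat \<Rightarrow> nat \<Rightarrow> real. \<forall>i<n. \<forall>j<n. f i j = (\<Sum>k<n. p k i * p k j)"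
  using assms
proof (induction n arbitrary: f)
  case 0
  then show ?case by simp
next
  case (Suc n)
  define a where "a = f n n"
  have split: "(\<Sum>i<Suc n. \<Sum>j<Suc n. v i * f i j * v j)
      = (\<Sum>i<n. \<Sum>j<n. v i * f i j * v j) + 2 * v n * (\<Sum>j<n. f n j * v j) + a * (v n)\<^sup>2" for v
  proof -
    have "(\<Sum>i<n. v i * f i n * v n) = v n * (\<Sum>j<n. f n j * v j)"
      unfolding sum_distrib_left using Suc.prems(1) by (intro sum.cong) auto
    moreover have "(\<Sum>j<n. v n * f n j * v j) = v n * (\<Sum>j<n. f n j * v j)"
      unfolding sum_distrib_left by (simp add: mult.assoc)
    ultimately show ?thesis
      by (simp add: sum.distrib a_def power2_eq_square algebra_simps)
  qed
  note form_nonneg = Suc.prems(2)[unfolded split]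
  have a_nonneg: "0 \<le> a"
    using form_nonneg[of "\<lambda>i. if i = n then 1 else 0"] by simp
  have zero: "f n j = 0" if "a = 0" "j < n" for j
  proof (rule nonneg_affine_imp_slope_zero)
    fix t :: real
    \<comment> \<open>The test vector is e_j + (t/2) e_n. Halving \<open>t\<close> cancels the
      factor 2 in \<open>split\<close>, and \<open>a = 0\<close> removes the quadratic term, so the
      form is affine in \<open>t\<close>.\<close>
    let ?v = "\<lambda>i. if i = n then t / 2 else if i = j then 1 else 0"
    have 1: "(\<Sum>i<n. f n i * ?v i) = f n j"
    proof -
      have "(\<Sum>i<n. f n i * ?v i) = (\<Sum>i<n. if i = j then f n j else 0)"
        by (intro sum.cong) auto
      then show ?thesis using that by simp
    qed
    have 2: "(\<Sum>i<n. \<Sum>k<n. ?v i * f i k * ?v k) = f j j"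
    proof -
      have "(\<Sum>i<n. \<Sum>k<n. ?v i * f i k * ?v k)
          = (\<Sum>i<n. \<Sum>k<n. if k = j then if i = j then f j j else 0 else 0)"
        by (intro sum.cong) auto
      then show ?thesis using that by simp
    qed
    show "0 \<le> f j j + t * f n j"
      using form_nonneg[of ?v] that(1) unfolding 1 2 by simp
  qed
  \<comment> \<open>The Schur complement of the last diagonal entry. Division by zero yields 0, so
    \<open>g\<close> is just \<open>f\<close> when \<open>a = 0\<close> and both cases can be
    treated together.\<close>
  define g where "g i j = f i j - f n i * f n j / a" for i j
  have "0 \<le> (\<Sum>i<n. \<Sum>j<n. v i * g i j * v j)" for v
  proof -
    define s where "s = (\<Sum>j<n. f n j * v j)"
    \<comment> \<open>For \<open>a > 0\<close> this last coordinate minimises the form with the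
      other coordinates fixed, and contributes -s^2/a. For \<open>a = 0\<close> it is 0 and
      contributes nothing.\<close>
    define w where "w = v(n := - s / a)"
    have "s\<^sup>2 / a = (\<Sum>i<n. \<Sum>j<n. v i * (f n i * f n j / a) * v j)"
      unfolding s_def power2_eq_square sum_product sum_divide_distrib
      by (intro sum.cong) (auto simp: field_simps)
    then have "(\<Sum>i<n. \<Sum>j<n. v i * g i j * v j) = (\<Sum>i<n. \<Sum>j<n. v i * f i j * v j) - s\<^sup>2 / a"
      by (simp add: g_def algebra_simps sum_subtractf)
    moreover have "(\<Sum>i<n. \<Sum>j<n. w i * f i j * w j) = (\<Sum>i<n. \<Sum>j<n. v i * f i j * v j)"
      "(\<Sum>j<n. f n j * w j) = s"
      by (simp_all add: w_def s_def)
    moreover have "2 * w n * s + a * (w n)\<^sup>2 = - s\<^sup>2 / a"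
      by (cases "a = 0") (simp_all add: w_def power2_eq_square field_simps)
    ultimately show ?thesis
      using form_nonneg[of w] by simp
  qed
  moreover have "g i j = g j i" if "i < n" "j < n" for i j
    using Suc.prems(1)[of i j] that by (simp add: g_def)
  ultimately obtain p :: "nat \<Rightarrow> nat \<Rightarrow> real"
    where p: "\<And>i j. i < n \<Longrightarrow> j < n \<Longrightarrow> g i j = (\<Sum>k<n. p k i * p k j)"
    using Suc.IH[of g] by blast
  \<comment> \<open>The new row \<open>n\<close> produces the rank-one term subtracted in
    \<open>g\<close>; the earlier rows are padded with a zero in column \<open>n\<close>. If
    \<open>a = 0\<close>, the new row is zero as well.\<close>
  define q where "q k i = (if k = n then f n i / sqrt a else if i = n then 0 else p k i)" for k i
  have "f i j = (\<Sum>k<Suc n. q k i * q k j)" if ij: "i < Suc n" "j < Suc n" for i j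
  proof -
    have last: "q n i * q n j = f n i * f n j / a"
      using a_nonneg by (simp add: q_def)
    consider "i < n" "j < n" | "i = n" | "j = n" using ij by linarith
    then show ?thesis
    proof cases
      case 1
      then have "(\<Sum>k<n. q k i * q k j) = g i j" by (simp add: p q_def)
      then show ?thesis using last by (simp add: g_def)
    next
      \<comment> \<open>The padding leaves only row \<open>n\<close>, which contributes
        \<open>f n n * f n j / a\<close>. For \<open>a = 0\<close> this is 0, and
        \<open>zero\<close> is what makes \<open>f n j\<close> agree with it.\<close>
      case 2
      then have "(\<Sum>k<n. q k i * q k j) = 0" by (simp add: q_def)
      moreover have "f n j = 0" if "a = 0"
        using zero[OF that] ij a_def that by (cases "j = n") auto
      ultimately show ?thesis
        using last 2 by (cases "a = 0") (simp_all add: a_def)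
    next
      case 3
      then have "(\<Sum>k<n. q k i * q k j) = 0" by (simp add: q_def)
      moreover have "f n i = 0" if "a = 0"
        using zero[OF that] ij a_def that by (cases "i = n") auto
      moreover have "f i n = f n i" using Suc.prems(1) ij by simp
      ultimately show ?thesis
        using last 3 by (cases "a = 0") (simp_all add: a_def)
    qed
  qed
  then show ?case by blast
qed

lemma psd_imp_gram:
  assumes "psd M" "M \<in> carrier_mat n n"
  obtains p :: "nat \<Rightarrow> nat \<Rightarrow> real"
  where "\<And>i j. i < n \<Longrightarrow> j < n \<Longrightarrow> M $$ (i, j) = (\<Sum>k<n. p k i * p k j)"
  using quadratic_form_nonneg_imp_gram[of n "\<lambda>i j. M $$ (i, j)"]
    psd_symmetric[OF assms] psd_quadratic_form_nonneg[OF assms] by blast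

section \<open>Pair indices and rearrangement of sums\<close>

lemma pair_index_less:
  fixes i j m n :: nat
  assumes "i < m" "j < n"
  shows "i * n + j < m * n"
proof -
  have "i * n + j < Suc i * n" using assms by simp
  also have "\<dots> \<le> m * n" using assms by (intro mult_le_mono1) simp
  finally show ?thesis .
qed

lemma pair_index_div:
  fixes i j n :: nat
  assumes "j < n"
  shows "(i * n + j) div n = i"
  using assms by (intro div_nat_eqI) (auto simp: algebra_simps)

text \<open>Cuts the range into \<open>m\<close> consecutive blocks of length \<open>n\<close>,
  which is the index layout of \<open>mat_kron\<close>.\<close>

lemma sum_lessThan_mult:
  fixes f :: "nat \<Rightarrow> 'a :: comm_monoid_add"
  shows "(\<Sum>k<m * n. f k) = (\<Sum>i<m. \<Sum>j<n. f (i * n + j))"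
proof -
  have "(\<Sum>k<m * n. f k) = (\<Sum>i<m. sum f {i * n..<i * n + n})"
    by (rule sum.nat_group[symmetric])
  also have "\<dots> = (\<Sum>i<m. \<Sum>j<n. f (i * n + j))"
    using sum.shift_bounds_nat_ivl[of f 0 "i * n" n for i]
    by (simp add: atLeast0LessThan add.commute)
  finally show ?thesis .
qed

lemma sum_swap_4_1:
  fixes f :: "'i \<Rightarrow> 'j \<Rightarrow> 'k \<Rightarrow> 'l \<Rightarrow> 'a \<Rightarrow> 'c :: comm_monoid_add"
  shows "(\<Sum>i\<in>I. \<Sum>j\<in>J. \<Sum>k\<in>K. \<Sum>l\<in>L. \<Sum>a\<in>A. f i j k l a)
    = (\<Sum>a\<in>A. \<Sum>i\<in>I. \<Sum>j\<in>J. \<Sum>k\<in>K. \<Sum>l\<in>L. f i j k l a)"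
  by (subst sum.swap[of _ A L], subst sum.swap[of _ A K], subst sum.swap[of _ A J],
      subst sum.swap[of _ A I], rule refl)

text \<open>Brings two sums, over Gram vectors or over constraint indices, outside the four sums
  over matrix entries. The first swap treats the sum over \<open>b\<close> as part of the
  summand.\<close>

lemma sum_swap_4_2:
  fixes f :: "'i \<Rightarrow> 'j \<Rightarrow> 'k \<Rightarrow> 'l \<Rightarrow> 'a \<Rightarrow> 'b \<Rightarrow> 'c :: comm_monoid_add"
  shows "(\<Sum>i\<in>I. \<Sum>j\<in>J. \<Sum>k\<in>K. \<Sum>l\<in>L. \<Sum>a\<in>A. \<Sum>b\<in>B. f i j k l a b)
    = (\<Sum>a\<in>A. \<Sum>b\<in>B. \<Sum>i\<in>I. \<Sum>j\<in>J. \<Sum>k\<in>K. \<Sum>l\<in>L. f i j k l a b)"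
  by (rule trans[OF sum_swap_4_1], rule sum.cong[OF refl], rule sum_swap_4_1)

lemma double_sum_product:
  fixes x :: "'a :: comm_semiring_0"
  shows "(\<Sum>a\<in>A. f a) * (\<Sum>b\<in>B. g b) * x = (\<Sum>a\<in>A. \<Sum>b\<in>B. f a * g b * x)"
  unfolding sum_product by (simp only: sum_distrib_right)

section \<open>Pairing a matrix with Kronecker products\<close>

lemma mat_inner_kron:
  assumes "A \<in> carrier_mat m m" "B \<in> carrier_mat n n"
  shows "mat_inner (mat_kron A B) X = (\<Sum>i<m. \<Sum>j<n. \<Sum>k<m. \<Sum>l<n.
      A $$ (i, k) * B $$ (j, l) * X $$ (i * n + j, k * n + l))"
  using assms
  by (auto simp: mat_inner_def mat_kron_def sum_lessThan_mult pair_index_less intro!: sum.cong)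

text \<open>Gram representations of both factors turn the pairing into a sum of values of the
  quadratic form of \<open>X\<close> at Kronecker products of Gram vectors.\<close>

lemma mat_inner_kron_nonneg:
  assumes M: "psd M" "M \<in> carrier_mat m m"
    and N: "psd N" "N \<in> carrier_mat n n"
    and X: "psd X" "X \<in> carrier_mat (m * n) (m * n)"
  shows "0 \<le> mat_inner (mat_kron M N) X"
proof -
  obtain p where p: "\<And>i j. i < m \<Longrightarrow> j < m \<Longrightarrow> M $$ (i, j) = (\<Sum>k<m. p k i * p k j)"
    using psd_imp_gram[OF M] by blast
  obtain q where q: "\<And>i j. i < n \<Longrightarrow> j < n \<Longrightarrow> N $$ (i, j) = (\<Sum>k<n. q k i * q k j)"
    using psd_imp_gram[OF N] by blast
  define w where "w a b i = p a (i div n) * q b (i mod n)" for a b i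
  define S where "S a b = (\<Sum>i<m. \<Sum>j<n. \<Sum>k<m. \<Sum>l<n.
      p a i * q b j * X $$ (i * n + j, k * n + l) * (p a k * q b l))" for a b
  \<comment> \<open>Under the pair encoding, \<open>w a b\<close> is the Kronecker product of the
    vectors \<open>p a\<close> and \<open>q b\<close>, so \<open>S a b\<close> is a single value of
    the form of \<open>X\<close>.\<close>
  have "S a b = (\<Sum>i<m * n. \<Sum>j<m * n. w a b i * X $$ (i, j) * w a b j)" for a b
    unfolding sum_lessThan_mult S_def by (intro sum.cong) (auto simp: w_def pair_index_div)
  then have S_nonneg: "0 \<le> S a b" for a b
    using psd_quadratic_form_nonneg[OF X] by simp
  have "mat_inner (mat_kron M N) X = (\<Sum>i<m. \<Sum>j<n. \<Sum>k<m. \<Sum>l<n. \<Sum>a<m. \<Sum>b<n.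
      p a i * q b j * X $$ (i * n + j, k * n + l) * (p a k * q b l))"
    unfolding mat_inner_kron[OF M(2) N(2)]
    by (intro sum.cong refl)
      (simp only: lessThan_iff p q double_sum_product, intro sum.cong refl, simp only: mult_ac)
  also have "\<dots> = (\<Sum>a<m. \<Sum>b<n. S a b)"
    unfolding S_def by (rule sum_swap_4_2)
  finally show ?thesis
    using S_nonneg by (simp add: sum_nonneg)
qed

lemma tuple_comb_carrier [simp]: "tuple_comb n y As \<in> carrier_mat n n"
  by (simp add: tuple_comb_def)

lemma tuple_comb_add:
  assumes "y \<in> carrier_vec (length As)" "z \<in> carrier_vec (length As)"
  shows "tuple_comb n y As + tuple_comb n z As = tuple_comb n (y + z) As"
  using assms by (intro eq_matI) (auto simp: tuple_comb_def sum.distrib algebra_simps)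

text \<open>Bilinearity of the Kronecker product. It exposes the constraint matrices of the product
  program, so that feasibility of \<open>X\<close> can be applied term by term.\<close>

lemma mat_inner_kron_tuple_comb:
  assumes As: "set As \<subseteq> carrier_mat m m" and Bs: "set Bs \<subseteq> carrier_mat n n"
  shows "mat_inner (mat_kron (tuple_comb m y As) (tuple_comb n z Bs)) X
    = (\<Sum>a<length As. \<Sum>b<length Bs. y $ a * z $ b * mat_inner (mat_kron (As ! a) (Bs ! b)) X)"
proof -
  define T where "T a b i j k l =
    y $ a * z $ b * ((As ! a) $$ (i, k) * (Bs ! b) $$ (j, l) * X $$ (i * n + j, k * n + l))"
    for a b i j k l
  have "mat_inner (mat_kron (tuple_comb m y As) (tuple_comb n z Bs)) X
      = (\<Sum>i<m. \<Sum>j<n. \<Sum>k<m. \<Sum>l<n. \<Sum>a<length As. \<Sum>b<length Bs. T a b i j k l)"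
    unfolding mat_inner_kron[OF tuple_comb_carrier tuple_comb_carrier] T_def
    by (intro sum.cong refl)
      (simp only: lessThan_iff tuple_comb_def index_mat prod.case double_sum_product,
        intro sum.cong refl, simp only: mult_ac)
  also have "\<dots> = (\<Sum>a<length As. \<Sum>b<length Bs. \<Sum>i<m. \<Sum>j<n. \<Sum>k<m. \<Sum>l<n. T a b i j k l)"
    by (rule sum_swap_4_2)
  also have "\<dots> = (\<Sum>a<length As. \<Sum>b<length Bs.
      y $ a * z $ b * mat_inner (mat_kron (As ! a) (Bs ! b)) X)"
  proof (intro sum.cong refl)
    fix a b assume "a \<in> {..<length As}" "b \<in> {..<length Bs}"
    then have "As ! a \<in> carrier_mat m m" "Bs ! b \<in> carrier_mat n n"
      using As Bs by (auto simp: subset_iff)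
    then show "(\<Sum>i<m. \<Sum>j<n. \<Sum>k<m. \<Sum>l<n. T a b i j k l)
        = y $ a * z $ b * mat_inner (mat_kron (As ! a) (Bs ! b)) X"
      by (simp add: mat_inner_kron T_def sum_distrib_left)
  qed
  finally show ?thesis .
qed

text \<open>The mixed terms, \<open>D\<close> with \<open>G\<close> and \<open>E\<close> with
  \<open>F\<close>, occur once with each sign and cancel.\<close>

lemma mat_inner_kron_diff_add:
  assumes "D \<in> carrier_mat m m" "E \<in> carrier_mat m m" "F \<in> carrier_mat n n" "G \<in> carrier_mat n n"
  shows "mat_inner (mat_kron (D - E) (F + G)) X + mat_inner (mat_kron (D + E) (F - G)) X
    = 2 * (mat_inner (mat_kron D F) X - mat_inner (mat_kron E G) X)"
proof -
  have *: "D - E \<in> carrier_mat m m" "D + E \<in> carrier_mat m m"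
    "F - G \<in> carrier_mat n n" "F + G \<in> carrier_mat n n"
    using assms by auto
  show ?thesis
    using assms
    by (simp add: mat_inner_kron[OF *(1,4)] mat_inner_kron[OF *(2,3)]
        mat_inner_kron[OF assms(1,3)] mat_inner_kron[OF assms(2,4)]
        sum_distrib_left flip: sum.distrib sum_subtractf)
      (auto intro!: sum.cong simp: algebra_simps)
qed

section \<open>Sign change along the bipartition\<close>

lemma psd_block_sign_change:
  assumes D: "D \<in> carrier_mat n n" and E: "E \<in> carrier_mat n n"
    and PQ: "P \<union> Q = {..<n}" "P \<inter> Q = {}"
    and diag: "block_diagonal P Q D" and anti: "block_antidiagonal P Q E"
    and psd: "psd (D - E)"
  shows "psd (D + E)"
proof -
  define s :: "nat \<Rightarrow> real" where "s i = (if i \<in> P then 1 else -1)" for i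
  have DE: "D - E \<in> carrier_mat n n" using D E by auto
  \<comment> \<open>The factor \<open>s i * s j\<close> is 1 within a part and -1 across parts.
    \<open>D\<close> vanishes across parts and \<open>E\<close> within them, so exactly
    \<open>E\<close> changes sign.\<close>
  have conj: "(D + E) $$ (i, j) = s i * (D - E) $$ (i, j) * s j" if "i < n" "j < n" for i j
  proof -
    have "i \<in> P \<and> j \<in> P \<or> i \<in> Q \<and> j \<in> Q \<or> i \<in> P \<and> j \<in> Q \<or> i \<in> Q \<and> j \<in> P"
      using PQ(1) that by blast
    then show ?thesis
      using PQ diag anti D E that
      unfolding block_diagonal_def block_antidiagonal_def s_def
      by (elim disjE) auto
  qed
  have "transpose_mat (D + E) = D + E"
  proof (rule eq_matI)
    fix i j assume "i < dim_row (D + E)" "j < dim_col (D + E)"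
    then have ij: "i < n" "j < n" using D E by auto
    then have "transpose_mat (D + E) $$ (i, j) = (D + E) $$ (j, i)" using D E by simp
    also have "\<dots> = (D + E) $$ (i, j)"
      unfolding conj[OF ij] conj[OF ij(2,1)] psd_symmetric[OF psd DE ij] by simp
    finally show "transpose_mat (D + E) $$ (i, j) = (D + E) $$ (i, j)" .
  qed (use D E in auto)
  moreover have "0 \<le> v \<bullet> ((D + E) *\<^sub>v v)" if v: "v \<in> carrier_vec n" for v
  proof -
    have "v \<bullet> ((D + E) *\<^sub>v v) = (\<Sum>i<n. \<Sum>j<n. v $ i * (D + E) $$ (i, j) * v $ j)"
      using D E v by (intro quadratic_form_eq_sum) auto
    also have "\<dots> = (\<Sum>i<n. \<Sum>j<n. (s i * v $ i) * (D - E) $$ (i, j) * (s j * v $ j))"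
      by (intro sum.cong refl) (simp only: lessThan_iff conj mult_ac)
    also have "0 \<le> \<dots>"
      by (rule psd_quadratic_form_nonneg[OF psd DE])
    finally show ?thesis .
  qed
  ultimately show ?thesis
    using D E by (auto simp: psd_def)
qed

lemma block_diagonal_tuple_comb:
  assumes "P \<union> Q = {..<n}" "\<forall>M \<in> set As. block_diagonal P Q M"
  shows "block_diagonal P Q (tuple_comb n y As)"
  unfolding block_diagonal_def
proof (intro allI impI)
  fix i j assume ij: "i \<in> P \<and> j \<in> Q \<or> i \<in> Q \<and> j \<in> P"
  then have "i < n" "j < n" using assms(1) by blast+
  moreover have "(As ! k) $$ (i, j) = 0" if "k < length As" for k
    using assms(2) ij nth_mem[OF that] unfolding block_diagonal_def by blast
  ultimately show "tuple_comb n y As $$ (i, j) = 0"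
    by (simp add: tuple_comb_def)
qed

lemma block_antidiagonal_tuple_comb:
  assumes "P \<union> Q = {..<n}" "\<forall>M \<in> set As. block_antidiagonal P Q M"
  shows "block_antidiagonal P Q (tuple_comb n y As)"
  unfolding block_antidiagonal_def
proof (intro allI impI)
  fix i j assume ij: "i \<in> P \<and> j \<in> P \<or> i \<in> Q \<and> j \<in> Q"
  then have "i < n" "j < n" using assms(1) by blast+
  moreover have "(As ! k) $$ (i, j) = 0" if "k < length As" for k
    using assms(2) ij nth_mem[OF that] unfolding block_antidiagonal_def by blast
  ultimately show "tuple_comb n y As $$ (i, j) = 0"
    by (simp add: tuple_comb_def)
qed

text \<open>Writing \<open>J\<close> as a combination of the tuple \<open>B\<close> with
  coefficients \<open>u\<close> merges it with the \<open>z\<close>-term into the single combination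
  with coefficients \<open>z + u\<close>, which is block anti-diagonal as a whole.\<close>

lemma dual_feasible_psd_pair:
  assumes "bipartite_sdp \<pi>" "(y, z) \<in> dual_feasible \<pi>"
    and "u \<in> carrier_vec (length (sdp_B \<pi>))" "sdp_J \<pi> = tuple_comb (sdp_dim \<pi>) u (sdp_B \<pi>)"
  defines "D \<equiv> tuple_comb (sdp_dim \<pi>) y (sdp_A \<pi>)"
    and "E \<equiv> tuple_comb (sdp_dim \<pi>) (z + u) (sdp_B \<pi>)"
  shows "psd (D - E)" "psd (D + E)"
proof -
  show "psd (D - E)"
    using assms(2,3) unfolding D_def E_def assms(4) dual_feasible_def
    by (auto simp: assms(4) tuple_comb_add)
  obtain P Q where "P \<union> Q = {..<sdp_dim \<pi>}" "P \<inter> Q = {}"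
    "\<forall>M \<in> set (sdp_B \<pi>). block_antidiagonal P Q M" "\<forall>M \<in> set (sdp_A \<pi>). block_diagonal P Q M"
    using assms(1) unfolding bipartite_sdp_def by blast
  then show "psd (D + E)"
    using \<open>psd (D - E)\<close> unfolding D_def E_def
    by (intro psd_block_sign_change[of _ "sdp_dim \<pi>" _ P Q]
        block_diagonal_tuple_comb block_antidiagonal_tuple_comb) auto
qed

section \<open>Weak duality bound for the product program\<close>

lemma nonneg_vec_index:
  fixes v :: "real vec"
  assumes "0\<^sub>v n \<le> v" "i < n"
  shows "0 \<le> v $ i"
  using assms by (auto simp: less_eq_vec_def)

lemma length_tuple_kron [simp]: "length (tuple_kron As Bs) = length As * length Bs"
  by (simp add: tuple_kron_def)

lemma tuple_inner_kron_nth: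
  assumes "a < length As" "b < length Bs"
  shows "tuple_inner (tuple_kron As Bs) X $ (a * length Bs + b)
    = mat_inner (mat_kron (As ! a) (Bs ! b)) X"
  using assms pair_index_less[OF assms]
  by (simp add: tuple_inner_def tuple_kron_def pair_index_div)

lemma sdp_dim_prod: "sdp_dim (sdp_prod \<pi>\<^sub>1 \<pi>\<^sub>2) = sdp_dim \<pi>\<^sub>1 * sdp_dim \<pi>\<^sub>2"
  by (simp add: sdp_dim_def sdp_prod_def mat_kron_def)

text \<open>Every comparison is made after pairing with the fixed feasible \<open>X\<close>, so no
  dual solution of the product program has to be constructed.\<close>

lemma mat_inner_prod_le_dual:
  assumes wf: "wf_sdp \<pi>\<^sub>1" "wf_sdp \<pi>\<^sub>2"
    and bip: "bipartite_sdp \<pi>\<^sub>1" "bipartite_sdp \<pi>\<^sub>2"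
    and u1: "u\<^sub>1 \<in> carrier_vec (length (sdp_B \<pi>\<^sub>1))" "0\<^sub>v (length (sdp_B \<pi>\<^sub>1)) \<le> u\<^sub>1"
      "sdp_J \<pi>\<^sub>1 = tuple_comb (sdp_dim \<pi>\<^sub>1) u\<^sub>1 (sdp_B \<pi>\<^sub>1)"
    and u2: "u\<^sub>2 \<in> carrier_vec (length (sdp_B \<pi>\<^sub>2))" "0\<^sub>v (length (sdp_B \<pi>\<^sub>2)) \<le> u\<^sub>2"
      "sdp_J \<pi>\<^sub>2 = tuple_comb (sdp_dim \<pi>\<^sub>2) u\<^sub>2 (sdp_B \<pi>\<^sub>2)"
    and X: "X \<in> primal_feasible (sdp_prod \<pi>\<^sub>1 \<pi>\<^sub>2)"
    and yz1: "(y\<^sub>1, z\<^sub>1) \<in> dual_feasible \<pi>\<^sub>1" and yz2: "(y\<^sub>2, z\<^sub>2) \<in> dual_feasible \<pi>\<^sub>2"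
  shows "mat_inner (sdp_J (sdp_prod \<pi>\<^sub>1 \<pi>\<^sub>2)) X \<le> (y\<^sub>1 \<bullet> sdp_b \<pi>\<^sub>1) * (y\<^sub>2 \<bullet> sdp_b \<pi>\<^sub>2)"
proof -
  let ?n1 = "sdp_dim \<pi>\<^sub>1" and ?n2 = "sdp_dim \<pi>\<^sub>2"
  let ?A1 = "sdp_A \<pi>\<^sub>1" and ?A2 = "sdp_A \<pi>\<^sub>2" and ?B1 = "sdp_B \<pi>\<^sub>1" and ?B2 = "sdp_B \<pi>\<^sub>2"
  let ?b1 = "sdp_b \<pi>\<^sub>1" and ?b2 = "sdp_b \<pi>\<^sub>2"
  define D1 where "D1 = tuple_comb ?n1 y\<^sub>1 ?A1"
  define D2 where "D2 = tuple_comb ?n2 y\<^sub>2 ?A2"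
  define E1 where "E1 = tuple_comb ?n1 (z\<^sub>1 + u\<^sub>1) ?B1"
  define E2 where "E2 = tuple_comb ?n2 (z\<^sub>2 + u\<^sub>2) ?B2"
  note psd1 = dual_feasible_psd_pair[OF bip(1) yz1 u1(1,3), folded D1_def E1_def]
  note psd2 = dual_feasible_psd_pair[OF bip(2) yz2 u2(1,3), folded D2_def E2_def]
  have carr: "D1 \<in> carrier_mat ?n1 ?n1" "E1 \<in> carrier_mat ?n1 ?n1"
    "D2 \<in> carrier_mat ?n2 ?n2" "E2 \<in> carrier_mat ?n2 ?n2"
    by (simp_all add: D1_def D2_def E1_def E2_def)
  have sets: "set ?A1 \<subseteq> carrier_mat ?n1 ?n1" "set ?A2 \<subseteq> carrier_mat ?n2 ?n2"
    "set ?B1 \<subseteq> carrier_mat ?n1 ?n1" "set ?B2 \<subseteq> carrier_mat ?n2 ?n2"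
    and b: "dim_vec ?b1 = length ?A1" "dim_vec ?b2 = length ?A2"
    using wf by (auto simp: wf_sdp_def)
  have Xpsd: "psd X" "X \<in> carrier_mat (?n1 * ?n2) (?n1 * ?n2)"
    and XA: "tuple_inner (tuple_kron ?A1 ?A2) X = vec_kron ?b1 ?b2"
    and XB: "0\<^sub>v (length ?B1 * length ?B2) \<le> tuple_inner (tuple_kron ?B1 ?B2) X"
    using X by (auto simp: primal_feasible_def sdp_dim_prod) (simp_all add: sdp_prod_def)
  have A_eq: "mat_inner (mat_kron (?A1 ! i) (?A2 ! j)) X = ?b1 $ i * ?b2 $ j"
    if "i < length ?A1" "j < length ?A2" for i j
    using tuple_inner_kron_nth[OF that, of X] that b pair_index_less[OF that]
    by (simp add: XA vec_kron_def pair_index_div)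
  have B_nonneg: "0 \<le> mat_inner (mat_kron (?B1 ! i) (?B2 ! j)) X"
    if "i < length ?B1" "j < length ?B2" for i j
    using tuple_inner_kron_nth[OF that, of X] XB pair_index_less[OF that]
    by (auto simp: less_eq_vec_def tuple_inner_def)
  \<comment> \<open>Adding the nonnegative \<open>z\<close> increases each factor, and nonnegativity
    of \<open>u\<close> lets the two inequalities be multiplied.\<close>
  have coeff: "u\<^sub>1 $ i * u\<^sub>2 $ j \<le> (z\<^sub>1 + u\<^sub>1) $ i * (z\<^sub>2 + u\<^sub>2) $ j"
    if "i < length ?B1" "j < length ?B2" for i j
  proof -
    have "0 \<le> z\<^sub>1 $ i" "0 \<le> z\<^sub>2 $ j"
      using yz1 yz2 that by (auto simp: dual_feasible_def intro: nonneg_vec_index)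
    moreover have "0 \<le> u\<^sub>1 $ i" "0 \<le> u\<^sub>2 $ j"
      using u1(2) u2(2) that by (auto intro: nonneg_vec_index)
    moreover have "dim_vec u\<^sub>1 = length ?B1" "dim_vec u\<^sub>2 = length ?B2"
      using u1(1) u2(1) by auto
    ultimately show ?thesis
      using that by (simp add: mult_mono)
  qed

  have "0 \<le> mat_inner (mat_kron (D1 - E1) (D2 + E2)) X"
    using carr by (intro mat_inner_kron_nonneg[OF psd1(1) _ psd2(2) _ Xpsd]) auto
  moreover have "0 \<le> mat_inner (mat_kron (D1 + E1) (D2 - E2)) X"
    using carr by (intro mat_inner_kron_nonneg[OF psd1(2) _ psd2(1) _ Xpsd]) auto
  ultimately have "0 \<le> 2 * (mat_inner (mat_kron D1 D2) X - mat_inner (mat_kron E1 E2) X)"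
    unfolding mat_inner_kron_diff_add[OF carr, symmetric] by (rule add_nonneg_nonneg)
  then have EE_le_DD: "mat_inner (mat_kron E1 E2) X \<le> mat_inner (mat_kron D1 D2) X"
    by simp

  have "mat_inner (sdp_J (sdp_prod \<pi>\<^sub>1 \<pi>\<^sub>2)) X
      = (\<Sum>i<length ?B1. \<Sum>j<length ?B2.
          u\<^sub>1 $ i * u\<^sub>2 $ j * mat_inner (mat_kron (?B1 ! i) (?B2 ! j)) X)"
    by (simp add: sdp_prod_def u1(3) u2(3) mat_inner_kron_tuple_comb[OF sets(3,4)])
  \<comment> \<open>Larger coefficients give a larger sum because the product's inequality
    constraints make every pairing with \<open>X\<close> nonnegative.\<close>
  also have "\<dots> \<le> (\<Sum>i<length ?B1. \<Sum>j<length ?B2.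
          (z\<^sub>1 + u\<^sub>1) $ i * (z\<^sub>2 + u\<^sub>2) $ j * mat_inner (mat_kron (?B1 ! i) (?B2 ! j)) X)"
    using coeff B_nonneg by (intro sum_mono mult_right_mono) auto
  also have "\<dots> = mat_inner (mat_kron E1 E2) X"
    unfolding E1_def E2_def by (rule mat_inner_kron_tuple_comb[OF sets(3,4), symmetric])
  also note EE_le_DD
  \<comment> \<open>The product's equality constraints evaluate each pairing to a product of
    right-hand sides, so the double sum factors.\<close>
  also have "mat_inner (mat_kron D1 D2) X = (\<Sum>i<length ?A1. \<Sum>j<length ?A2.
          y\<^sub>1 $ i * y\<^sub>2 $ j * (?b1 $ i * ?b2 $ j))"
    unfolding D1_def D2_def mat_inner_kron_tuple_comb[OF sets(1,2)]
    by (intro sum.cong refl) (simp add: A_eq)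
  also have "\<dots> = (y\<^sub>1 \<bullet> ?b1) * (y\<^sub>2 \<bullet> ?b2)"
    by (simp add: scalar_prod_def b atLeast0LessThan sum_product mult_ac)
  finally show ?thesis .
qed

section \<open>Passage to the optimal values\<close>

text \<open>The dual optimum need not be attained. Finiteness of \<open>r\<close> makes
  \<open>r + inverse (real (Suc n))\<close> strictly larger than the infimum, so some feasible pair
  lies below it.\<close>

lemma dual_value_real_approx:
  assumes "dual_value \<pi> = ereal r"
  obtains y z :: "nat \<Rightarrow> real vec"
  where "\<And>n. (y n, z n) \<in> dual_feasible \<pi>" "(\<lambda>n. y n \<bullet> sdp_b \<pi>) \<longlonglongrightarrow> r"
proof -
  have lower: "r \<le> y \<bullet> sdp_b \<pi>" if "(y, z) \<in> dual_feasible \<pi>" for y z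
  proof -
    have "dual_value \<pi> \<le> ereal (y \<bullet> sdp_b \<pi>)"
      unfolding dual_value_def using INF_lower[OF that, of "\<lambda>(y, z). ereal (y \<bullet> sdp_b \<pi>)"] by simp
    then show ?thesis using assms by simp
  qed
  have "\<exists>y z. (y, z) \<in> dual_feasible \<pi> \<and> y \<bullet> sdp_b \<pi> < r + inverse (real (Suc n))" for n
  proof -
    have "dual_value \<pi> < ereal (r + inverse (real (Suc n)))"
      unfolding assms by simp
    then show ?thesis
      unfolding dual_value_def INF_less_iff by auto
  qed
  then obtain y z where yz: "\<And>n. (y n, z n) \<in> dual_feasible \<pi>"
    "\<And>n. y n \<bullet> sdp_b \<pi> < r + inverse (real (Suc n))"
    by metis
  have "(\<lambda>n. y n \<bullet> sdp_b \<pi>) \<longlonglongrightarrow> r"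
  proof (rule tendsto_sandwich)
    show "\<forall>\<^sub>F n in sequentially. r \<le> y n \<bullet> sdp_b \<pi>"
      using lower yz(1) by (intro always_eventually) blast
    show "\<forall>\<^sub>F n in sequentially. y n \<bullet> sdp_b \<pi> \<le> r + inverse (real (Suc n))"
      using yz(2) by (intro always_eventually) (blast intro: less_imp_le)
    show "(\<lambda>n. r + inverse (real (Suc n))) \<longlonglongrightarrow> r"
      using LIMSEQ_inverse_real_of_nat_add[of r] by simp
    show "(\<lambda>n. r) \<longlonglongrightarrow> r" by simp
  qed
  with yz(1) that show thesis by blast
qed

theorem theorem2:
  fixes \<pi>\<^sub>1 \<pi>\<^sub>2 :: sdp
  assumes "wf_sdp \<pi>\<^sub>1" and "wf_sdp \<pi>\<^sub>2"
    and "strong_duality \<pi>\<^sub>1" and "strong_duality \<pi>\<^sub>2"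
    and "bipartite_sdp \<pi>\<^sub>1" and "bipartite_sdp \<pi>\<^sub>2"
    and "\<exists>u\<^sub>1 \<in> carrier_vec (length (sdp_B \<pi>\<^sub>1)). 0\<^sub>v (length (sdp_B \<pi>\<^sub>1)) \<le> u\<^sub>1 \<and>
           sdp_J \<pi>\<^sub>1 = tuple_comb (sdp_dim \<pi>\<^sub>1) u\<^sub>1 (sdp_B \<pi>\<^sub>1)"
    and "\<exists>u\<^sub>2 \<in> carrier_vec (length (sdp_B \<pi>\<^sub>2)). 0\<^sub>v (length (sdp_B \<pi>\<^sub>2)) \<le> u\<^sub>2 \<and>
           sdp_J \<pi>\<^sub>2 = tuple_comb (sdp_dim \<pi>\<^sub>2) u\<^sub>2 (sdp_B \<pi>\<^sub>2)"
  shows "primal_value (sdp_prod \<pi>\<^sub>1 \<pi>\<^sub>2) \<le> primal_value \<pi>\<^sub>1 * primal_value \<pi>\<^sub>2"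
proof -
  obtain r1 r2 where r: "primal_value \<pi>\<^sub>1 = ereal r1" "dual_value \<pi>\<^sub>1 = ereal r1"
    "primal_value \<pi>\<^sub>2 = ereal r2" "dual_value \<pi>\<^sub>2 = ereal r2"
    using assms(3,4) by (auto simp: strong_duality_def)
  obtain y1 z1 where 1: "\<And>n. (y1 n, z1 n) \<in> dual_feasible \<pi>\<^sub>1" "(\<lambda>n. y1 n \<bullet> sdp_b \<pi>\<^sub>1) \<longlonglongrightarrow> r1"
    using dual_value_real_approx[OF r(2)] by blast
  obtain y2 z2 where 2: "\<And>n. (y2 n, z2 n) \<in> dual_feasible \<pi>\<^sub>2" "(\<lambda>n. y2 n \<bullet> sdp_b \<pi>\<^sub>2) \<longlonglongrightarrow> r2"
    using dual_value_real_approx[OF r(4)] by blast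
  \<comment> \<open>Taking the limit of the products of dual values avoids any assumption on the
    signs of these values.\<close>
  have "mat_inner (sdp_J (sdp_prod \<pi>\<^sub>1 \<pi>\<^sub>2)) X \<le> r1 * r2"
    if X: "X \<in> primal_feasible (sdp_prod \<pi>\<^sub>1 \<pi>\<^sub>2)" for X
  proof (rule LIMSEQ_le_const)
    show "(\<lambda>n. (y1 n \<bullet> sdp_b \<pi>\<^sub>1) * (y2 n \<bullet> sdp_b \<pi>\<^sub>2)) \<longlonglongrightarrow> r1 * r2"
      using 1(2) 2(2) by (rule tendsto_mult)
    show "\<exists>N. \<forall>n\<ge>N. mat_inner (sdp_J (sdp_prod \<pi>\<^sub>1 \<pi>\<^sub>2)) X
        \<le> (y1 n \<bullet> sdp_b \<pi>\<^sub>1) * (y2 n \<bullet> sdp_b \<pi>\<^sub>2)"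
      using assms(7,8) mat_inner_prod_le_dual[OF assms(1,2,5,6) _ _ _ _ _ _ X 1(1) 2(1)] by blast
  qed
  \<comment> \<open>This also covers an infeasible product program, whose value is minus
    infinity.\<close>
  then show ?thesis
    unfolding r primal_value_def[of "sdp_prod \<pi>\<^sub>1 \<pi>\<^sub>2"] by (auto intro!: SUP_least)
qed

end
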